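(* There exists an absolute constant $K>0$ such that the following holds. Let $q$ be a prime power with $q\equiv 3\bmod 4$, let $U\subset\mathbb{F}_q^2$, $P=U\times U\subset\mathbb{F}_q^4$, and let $R\subset SF'(2,q)$. Then the number $I(P,R)$ of incidences between $P$ and $R$ satisfies \[I(P,R)\le K\left(|P||R|^{2/5}+|R|^{6/5}\right).\] In particular, if $|P|=|R|=N$, then $I(P,R)\ll N^{\frac32-\frac1{10}}$, with an absolute implied constant.
   Context: $\mathbb{F}_q$ is the finite field of order $q$. $SO(2,q)$ is the group of $2\times2$ orthogonal matrices over $\mathbb{F}_q$ with determinant $1$; $T(2,q)$ is the group of translations of $\mathbb{F}_q^2$; $SF(2,q)$ is the group of positively oriented rigid motions, i.e. maps $t\circ g$ with $t\in T(2,q)$ and $g\in SO(2,q)$; and $SF'(2,q)=SF(2,q)\setminus T(2,q)$. A point $(u,v)\in\mathbb{F}_q^2\times\mathbb{F}_q^2$ is incident to a rigid motion $r=(g,z)$ if $gu+z=v$, and $I(P,R)$ is the number of pairs $((u,v),r)\in P\times R$ such that $(u,v)$ is incident to $r$. *)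

theory Defs
  imports Complex_Main "HOL-Library.FuncSet" "HOL-Algebra.Weak_Morphisms"
    "HOL-Number_Theory.Prime_Powers"
begin

text \<open>
  The constant has to be chosen before the field, so the field cannot be a type variable: a type
  variable would be quantified outside the existential quantifier for the constant. A finite field
  is therefore a ring record in the sense of \<open>HOL-Algebra\<close>, with a finite carrier. Its elements
  are natural numbers in the theorem, which loses nothing by the following lemma.
\<close>

lemma finite_field_isomorphic_nat_field:
  assumes "field F" and "finite (carrier F)"
  shows "\<exists>G :: nat ring. field G \<and> finite (carrier G) \<and> F \<simeq> G"
proof -
  interpret field F by fact
  obtain f :: "_ \<Rightarrow> nat" where f: "inj_on f (carrier F)"
    using assms(2) finite_imp_inj_to_nat_seg by blast
  have "field (image_ring f F)"
    by (rule inj_imp_image_ring_is_field [OF f])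
  moreover have "F \<simeq> image_ring f F"
    unfolding is_ring_iso_def using inj_imp_image_ring_iso [OF f] by blast
  moreover have "finite (carrier (image_ring f F))"
    using assms(2) by (simp add: image_ring_carrier)
  ultimately show ?thesis
    by blast
qed

type_synonym 'a vec2 = "'a \<times> 'a"

text \<open>A \<open>2 \<times> 2\<close> matrix is the pair of its rows.\<close>

type_synonym 'a mat2 = "'a vec2 \<times> 'a vec2"

definition plane :: "'a ring \<Rightarrow> 'a vec2 set" where
  "plane F = carrier F \<times> carrier F"

definition matrices :: "'a ring \<Rightarrow> 'a mat2 set" where
  "matrices F = plane F \<times> plane F"

fun vec_add :: "'a ring \<Rightarrow> 'a vec2 \<Rightarrow> 'a vec2 \<Rightarrow> 'a vec2" where
  "vec_add F (x, y) (x', y') = (x \<oplus>\<^bsub>F\<^esub> x', y \<oplus>\<^bsub>F\<^esub> y')"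

fun mat_vec :: "'a ring \<Rightarrow> 'a mat2 \<Rightarrow> 'a vec2 \<Rightarrow> 'a vec2" where
  "mat_vec F ((a, b), (c, d)) (x, y) =
     (a \<otimes>\<^bsub>F\<^esub> x \<oplus>\<^bsub>F\<^esub> b \<otimes>\<^bsub>F\<^esub> y, c \<otimes>\<^bsub>F\<^esub> x \<oplus>\<^bsub>F\<^esub> d \<otimes>\<^bsub>F\<^esub> y)"

fun mat_mult :: "'a ring \<Rightarrow> 'a mat2 \<Rightarrow> 'a mat2 \<Rightarrow> 'a mat2" where
  "mat_mult F ((a, b), (c, d)) ((a', b'), (c', d')) =
     ((a \<otimes>\<^bsub>F\<^esub> a' \<oplus>\<^bsub>F\<^esub> b \<otimes>\<^bsub>F\<^esub> c', a \<otimes>\<^bsub>F\<^esub> b' \<oplus>\<^bsub>F\<^esub> b \<otimes>\<^bsub>F\<^esub> d'),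
      (c \<otimes>\<^bsub>F\<^esub> a' \<oplus>\<^bsub>F\<^esub> d \<otimes>\<^bsub>F\<^esub> c', c \<otimes>\<^bsub>F\<^esub> b' \<oplus>\<^bsub>F\<^esub> d \<otimes>\<^bsub>F\<^esub> d'))"

definition mat_id :: "'a ring \<Rightarrow> 'a mat2" where
  "mat_id F = ((\<one>\<^bsub>F\<^esub>, \<zero>\<^bsub>F\<^esub>), (\<zero>\<^bsub>F\<^esub>, \<one>\<^bsub>F\<^esub>))"

fun mat_transpose :: "'a mat2 \<Rightarrow> 'a mat2" where
  "mat_transpose ((a, b), (c, d)) = ((a, c), (b, d))"

fun mat_det :: "'a ring \<Rightarrow> 'a mat2 \<Rightarrow> 'a" where
  "mat_det F ((a, b), (c, d)) = a \<otimes>\<^bsub>F\<^esub> d \<ominus>\<^bsub>F\<^esub> b \<otimes>\<^bsub>F\<^esub> c"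

definition SO2 :: "'a ring \<Rightarrow> 'a mat2 set" where
  "SO2 F = {g \<in> matrices F.
     mat_mult F (mat_transpose g) g = mat_id F \<and>
     mat_mult F g (mat_transpose g) = mat_id F \<and>
     mat_det F g = \<one>\<^bsub>F\<^esub>}"

text \<open>
  Motions are maps of the plane to itself. They are extensional functions (\<open>undefined\<close> outside
  \<^term>\<open>plane F\<close>), so that sets of motions have the intended equality and cardinality.
\<close>

definition translation :: "'a ring \<Rightarrow> 'a vec2 \<Rightarrow> 'a vec2 \<Rightarrow> 'a vec2" where
  "translation F z = (\<lambda>x \<in> plane F. vec_add F x z)"

definition linear_motion :: "'a ring \<Rightarrow> 'a mat2 \<Rightarrow> 'a vec2 \<Rightarrow> 'a vec2" where
  "linear_motion F g = (\<lambda>x \<in> plane F. mat_vec F g x)"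

definition rigid_motion :: "'a ring \<Rightarrow> 'a mat2 \<Rightarrow> 'a vec2 \<Rightarrow> 'a vec2 \<Rightarrow> 'a vec2" where
  "rigid_motion F g z = compose (plane F) (translation F z) (linear_motion F g)"

definition T2 :: "'a ring \<Rightarrow> ('a vec2 \<Rightarrow> 'a vec2) set" where
  "T2 F = {translation F z | z. z \<in> plane F}"

definition SF2 :: "'a ring \<Rightarrow> ('a vec2 \<Rightarrow> 'a vec2) set" where
  "SF2 F = {rigid_motion F g z | g z. g \<in> SO2 F \<and> z \<in> plane F}"

definition SF2' :: "'a ring \<Rightarrow> ('a vec2 \<Rightarrow> 'a vec2) set" where
  "SF2' F = SF2 F - T2 F"

definition incident :: "'a ring \<Rightarrow> 'a vec2 \<times> 'a vec2 \<Rightarrow> ('a vec2 \<Rightarrow> 'a vec2) \<Rightarrow> bool" where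
  "incident F p r \<longleftrightarrow>
     (\<exists>g \<in> SO2 F. \<exists>z \<in> plane F. r = rigid_motion F g z \<and>
        vec_add F (mat_vec F g (fst p)) z = snd p)"

definition incidences ::
  "'a ring \<Rightarrow> ('a vec2 \<times> 'a vec2) set \<Rightarrow> ('a vec2 \<Rightarrow> 'a vec2) set \<Rightarrow> nat" where
  "incidences F P R = card {(p, r). p \<in> P \<and> r \<in> R \<and> incident F p r}"

end

theory Submission
  imports Defs "HOL-Algebra.Multiplicative_Group" "HOL-Analysis.Convex"
begin

text \<open>
  Write \<open>n = |U|\<close>, \<open>m = |R|\<close> and \<open>I = I(P, R)\<close>. The proof is double counting; the only facts about the
  plane that it needs are that a motion preserves the form \<open>x\<^sup>2 + y\<^sup>2\<close> of differences, that a motion is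
  determined by the images of two points, and that two circles with different centres meet in at
  most two points. The last two hold because \<open>x\<^sup>2 + y\<^sup>2\<close> has no nontrivial zero, which is where
  \<open>q \<equiv> 3\<close> modulo \<open>4\<close> enters (\<open>sum_of_squares_anisotropic\<close>).

  By Cauchy-Schwarz, \<open>I\<^sup>2\<close> is at most \<open>m\<close> times the number of triples of a motion \<open>r\<close> in \<open>R\<close> and two
  incident points \<open>(a, c)\<close>, \<open>(b, d)\<close> of \<open>U \<times> U\<close>. If the two points coincide the triple is an incidence;
  otherwise \<open>|ab| = |cd|\<close> and \<open>r\<close> is determined. So \<open>I\<^sup>2 \<le> m (I + Q)\<close>, where \<open>Q\<close> is the number of
  quadruples in \<open>U\<close> with \<open>|ab| = |cd|\<close> (\<open>motion_incidences_square_le\<close>).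

  The energy \<open>Q\<close> is \<open>O(n\<^bsup>7/2\<^esup>)\<close> (\<open>distance_energy_le\<close>). A second use of Cauchy-Schwarz bounds it by \<open>n\<close>
  times the number of isosceles triangles in \<open>U\<close>. If one end \<open>b\<close> of the base is fixed, then two apexes
  allow at most two positions of the other end, the intersections of two circles through \<open>b\<close>. A
  third use of Cauchy-Schwarz gives \<open>O(n\<^bsup>3/2\<^esup>)\<close> triangles for each \<open>b\<close> (\<open>isosceles_at_base_le\<close>).

  Hence \<open>I\<close> is \<open>O(m + m\<^bsup>1/2\<^esup> n\<^bsup>7/4\<^esup>)\<close>, and both terms are at most a constant times
  \<open>n\<^sup>2 m\<^bsup>2/5\<^esup> + m\<^bsup>6/5\<^esup>\<close> (\<open>incidence_exponents\<close>).
\<close>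

section \<open>Counting incidences and equal distances\<close>

text \<open>
  The Cauchy-Schwarz step behind both the point-circle and the point-motion bound: squaring the
  degrees of the elements of \<open>D\<close> counts pairs in \<open>A\<close> with a common neighbour, and the pairs on the
  diagonal give back \<open>I\<close>.
\<close>

lemma incidence_square_le:
  fixes rel :: "'a \<Rightarrow> 'd \<Rightarrow> bool" and I :: real
  assumes "finite A" and "finite D"
  defines "I \<equiv> \<Sum>d\<in>D. \<Sum>a\<in>A. of_bool (rel a d)"
  shows "I\<^sup>2 \<le> card D * (I + (\<Sum>a\<in>A. \<Sum>a'\<in>A - {a}. \<Sum>d\<in>D. of_bool (rel a d \<and> rel a' d)))"
proof -
  have split: "(\<Sum>a'\<in>A. \<Sum>d\<in>D. of_bool (rel a d \<and> rel a' d) :: real)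
      = (\<Sum>d\<in>D. of_bool (rel a d)) + (\<Sum>a'\<in>A - {a}. \<Sum>d\<in>D. of_bool (rel a d \<and> rel a' d))"
    if "a \<in> A" for a
    using that assms by (simp add: sum.remove)
  have "(\<Sum>d\<in>D. (\<Sum>a\<in>A. of_bool (rel a d) :: real)\<^sup>2)
      = (\<Sum>d\<in>D. \<Sum>a\<in>A. \<Sum>a'\<in>A. of_bool (rel a d \<and> rel a' d))"
    by (simp add: power2_eq_square sum_product of_bool_conj)
  also have "\<dots> = (\<Sum>a\<in>A. \<Sum>a'\<in>A. \<Sum>d\<in>D. of_bool (rel a d \<and> rel a' d))"
    by (subst sum.swap) (simp add: sum.swap[of _ A D])
  also have "\<dots> = I + (\<Sum>a\<in>A. \<Sum>a'\<in>A - {a}. \<Sum>d\<in>D. of_bool (rel a d \<and> rel a' d))"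
    by (simp add: split I_def sum.distrib sum.swap[of _ A D] cong: sum.cong)
  finally show ?thesis
    using sum_squared_le_sum_of_squares[of "\<lambda>d. \<Sum>a\<in>A. of_bool (rel a d) :: real" D] assms(2)
    by (simp add: I_def mult.commute)
qed

text \<open>
  The triangles counted have apex \<open>a\<close> and base from \<open>b\<close> to \<open>d\<close>. Two apexes leave at most two choices
  for \<open>d\<close>, so this is an incidence count with bounded common neighbourhoods. The constant three is
  one for the diagonal, estimated trivially, plus the two points of intersection.
\<close>

lemma isosceles_at_base_le:
  fixes \<delta> :: "'a \<Rightarrow> 'a \<Rightarrow> 't"
  assumes "finite U" and "b \<in> U"
    and circles: "\<And>a a'. a \<in> U \<Longrightarrow> a' \<in> U \<Longrightarrow> a \<noteq> a' \<Longrightarrow>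
      card {d \<in> U. \<delta> a b = \<delta> a d \<and> \<delta> a' b = \<delta> a' d} \<le> 2"
  shows "(\<Sum>d\<in>U. \<Sum>a\<in>U. of_bool (\<delta> a b = \<delta> a d) :: real) \<le> sqrt 3 * card U powr (3/2)"
proof -
  let ?n = "real (card U)"
  let ?T = "\<Sum>d\<in>U. \<Sum>a\<in>U. of_bool (\<delta> a b = \<delta> a d) :: real"
  let ?S = "\<Sum>a\<in>U. \<Sum>a'\<in>U - {a}. \<Sum>d\<in>U. of_bool (\<delta> a b = \<delta> a d \<and> \<delta> a' b = \<delta> a' d) :: real"
  have "?T \<le> (\<Sum>d\<in>U. \<Sum>a\<in>U. 1)"
    by (intro sum_mono) auto
  hence T: "?T \<le> ?n\<^sup>2"
    by (simp add: power2_eq_square)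
  have "(\<Sum>a'\<in>U - {a}. \<Sum>d\<in>U. of_bool (\<delta> a b = \<delta> a d \<and> \<delta> a' b = \<delta> a' d) :: real) \<le> 2 * ?n"
    if "a \<in> U" for a
  proof -
    have "(\<Sum>a'\<in>U - {a}. \<Sum>d\<in>U. of_bool (\<delta> a b = \<delta> a d \<and> \<delta> a' b = \<delta> a' d) :: real)
        \<le> (\<Sum>a'\<in>U - {a}. 2)"
    proof (intro sum_mono)
      fix a' assume a': "a' \<in> U - {a}"
      hence "a \<noteq> a'" by blast
      thus "(\<Sum>d\<in>U. of_bool (\<delta> a b = \<delta> a d \<and> \<delta> a' b = \<delta> a' d) :: real) \<le> 2"
        using circles[of a a'] that a' assms(1)
        by (simp add: sum_of_bool_eq Int_def del: of_bool_conj)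
    qed
    also have "\<dots> \<le> 2 * ?n"
      using assms(1) by (simp add: card_mono)
    finally show ?thesis .
  qed
  hence "?S \<le> (\<Sum>a\<in>U. 2 * ?n)"
    by (intro sum_mono) auto
  hence S: "?S \<le> 2 * ?n\<^sup>2"
    by (simp add: power2_eq_square)
  have "?T\<^sup>2 \<le> ?n * (?T + ?S)"
    using incidence_square_le[OF assms(1) assms(1), of "\<lambda>a d. \<delta> a b = \<delta> a d"] by simp
  also have "\<dots> \<le> ?n * (?n\<^sup>2 + 2 * ?n\<^sup>2)"
    using T S by (intro mult_left_mono add_mono) auto
  also have "\<dots> = (sqrt 3 * ?n powr (3/2))\<^sup>2"
  proof -
    have "?n > 0" using assms by (auto simp: card_gt_0_iff)
    hence "(?n powr (3/2))\<^sup>2 = ?n ^ 3"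
      by (simp add: powr_power powr_numeral)
    thus ?thesis
      unfolding power_mult_distrib by (simp add: power3_eq_cube power2_eq_square)
  qed
  finally show ?thesis
    by (rule power2_le_imp_le) auto
qed

text \<open>
  With \<open>x t\<close> and \<open>y t\<close> the sizes of the fibres of \<open>f\<close> and \<open>g\<close> over \<open>t\<close>, this is \<open>2 x y \<le> x\<^sup>2 + y\<^sup>2\<close>
  summed over \<open>t\<close>.
\<close>

lemma equal_pairs_le_mean:
  fixes f g :: "'a \<Rightarrow> 't"
  assumes "finite U"
  shows "2 * (\<Sum>b\<in>U. \<Sum>d\<in>U. of_bool (f b = g d) :: real)
    \<le> (\<Sum>b\<in>U. \<Sum>d\<in>U. of_bool (f b = f d)) + (\<Sum>b\<in>U. \<Sum>d\<in>U. of_bool (g b = g d))"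
proof -
  define V where "V = f ` U \<union> g ` U"
  have V: "finite V" "\<And>b. b \<in> U \<Longrightarrow> f b \<in> V" "\<And>b. b \<in> U \<Longrightarrow> g b \<in> V"
    using assms by (auto simp: V_def)
  have fibres: "(\<Sum>b\<in>U. \<Sum>d\<in>U. of_bool (h b = k d) :: real)
      = (\<Sum>t\<in>V. (\<Sum>b\<in>U. of_bool (h b = t)) * (\<Sum>d\<in>U. of_bool (k d = t)))"
    if "\<And>b. b \<in> U \<Longrightarrow> h b \<in> V" for h k :: "'a \<Rightarrow> 't"
  proof -
    have "(\<Sum>t\<in>V. (\<Sum>b\<in>U. of_bool (h b = t)) * (\<Sum>d\<in>U. of_bool (k d = t)))
        = (\<Sum>b\<in>U. \<Sum>d\<in>U. \<Sum>t\<in>V. of_bool (h b = t) * of_bool (k d = t) :: real)"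
      by (simp add: sum_product sum.swap[of _ U V])
    also have "\<dots> = (\<Sum>b\<in>U. \<Sum>d\<in>U. of_bool (h b = k d))"
    proof (intro sum.cong refl)
      fix b d assume "b \<in> U"
      have "(\<Sum>t\<in>V. of_bool (h b = t) * of_bool (k d = t) :: real)
          = (\<Sum>t\<in>V. if t = h b then of_bool (h b = k d) else 0)"
        by (intro sum.cong) auto
      thus "(\<Sum>t\<in>V. of_bool (h b = t) * of_bool (k d = t) :: real) = of_bool (h b = k d)"
        using that[OF \<open>b \<in> U\<close>] V(1) by simp
    qed
    finally show ?thesis ..
  qed
  have amgm: "2 * (x * y) \<le> x * x + y * y" for x y :: real
    using sum_squares_bound[of x y] by (simp add: power2_eq_square)
  show ?thesis
    by (simp only: fibres V(2,3) sum_distrib_left[of 2 _ V] sum.distrib[of _ _ V, symmetric])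
      (intro sum_mono amgm)
qed

text \<open>
  Comparing \<open>\<delta> a\<close> and \<open>\<delta> c\<close> by the previous lemma replaces pairs of segments of equal length by pairs
  with the common endpoint \<open>a\<close>, that is by isosceles triangles, at the cost of a factor \<open>card U\<close>.
\<close>

lemma distance_energy_le:
  fixes \<delta> :: "'a \<Rightarrow> 'a \<Rightarrow> 't"
  assumes "finite U"
    and circles: "\<And>a a' b. a \<in> U \<Longrightarrow> a' \<in> U \<Longrightarrow> b \<in> U \<Longrightarrow> a \<noteq> a' \<Longrightarrow>
      card {d \<in> U. \<delta> a b = \<delta> a d \<and> \<delta> a' b = \<delta> a' d} \<le> 2"
  shows "(\<Sum>a\<in>U. \<Sum>c\<in>U. \<Sum>b\<in>U. \<Sum>d\<in>U. of_bool (\<delta> a b = \<delta> c d) :: real)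
    \<le> sqrt 3 * card U powr (7/2)"
proof -
  let ?n = "real (card U)"
  let ?M = "\<lambda>a c. \<Sum>b\<in>U. \<Sum>d\<in>U. of_bool (\<delta> a b = \<delta> c d) :: real"
  have "2 * (\<Sum>a\<in>U. \<Sum>c\<in>U. ?M a c) \<le> (\<Sum>a\<in>U. \<Sum>c\<in>U. ?M a a + ?M c c)"
    unfolding sum_distrib_left
    using equal_pairs_le_mean[OF assms(1)] by (intro sum_mono) (simp add: sum_distrib_left)
  also have "\<dots> = 2 * (?n * (\<Sum>a\<in>U. ?M a a))"
    by (simp add: sum.distrib sum_distrib_left)
  finally have "(\<Sum>a\<in>U. \<Sum>c\<in>U. ?M a c) \<le> ?n * (\<Sum>a\<in>U. ?M a a)"
    by simp
  also have "(\<Sum>a\<in>U. ?M a a) = (\<Sum>b\<in>U. \<Sum>d\<in>U. \<Sum>a\<in>U. of_bool (\<delta> a b = \<delta> a d))"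
    by (subst sum.swap) (intro sum.cong refl sum.swap)
  also have "\<dots> \<le> (\<Sum>b\<in>U. sqrt 3 * ?n powr (3/2))"
    by (intro sum_mono isosceles_at_base_le assms) auto
  also have "?n * \<dots> = sqrt 3 * ?n powr (7/2)"
  proof (cases "card U = 0")
    case False
    have "?n powr (7/2) = ?n powr 2 * ?n powr (3/2)"
      using powr_add[of ?n 2 "3/2"] by simp
    thus ?thesis using False by (simp add: powr_numeral power2_eq_square)
  qed simp
  finally show ?thesis by (simp add: mult_left_mono)
qed

text \<open>
  Two points \<open>(a, c)\<close> and \<open>(b, d)\<close> of \<open>U \<times> U\<close> lie on a common motion only if the segments \<open>ab\<close> and \<open>cd\<close>
  have equal length, and then on just one. Here it matters that the point set is a product: all
  four endpoints range over the same set \<open>U\<close>.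
\<close>

lemma motion_incidences_square_le:
  fixes \<delta> :: "'a \<Rightarrow> 'a \<Rightarrow> 't" and R :: "('a \<Rightarrow> 'a) set" and I :: real
  assumes "finite U" and "finite R"
    and isometry: "\<And>r u u'. r \<in> R \<Longrightarrow> u \<in> U \<Longrightarrow> u' \<in> U \<Longrightarrow> \<delta> (r u) (r u') = \<delta> u u'"
    and rigid: "\<And>r r' u u'. r \<in> R \<Longrightarrow> r' \<in> R \<Longrightarrow> u \<in> U \<Longrightarrow> u' \<in> U \<Longrightarrow> u \<noteq> u' \<Longrightarrow>
      r u = r' u \<Longrightarrow> r u' = r' u' \<Longrightarrow> r = r'"
  defines "I \<equiv> \<Sum>r\<in>R. \<Sum>p\<in>U \<times> U. of_bool (r (fst p) = snd p)"
  shows "I\<^sup>2 \<le> card R * (I + (\<Sum>a\<in>U. \<Sum>c\<in>U. \<Sum>b\<in>U. \<Sum>d\<in>U. of_bool (\<delta> a b = \<delta> c d)))"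
proof -
  let ?P = "U \<times> U"
  let ?S = "\<Sum>p\<in>?P. \<Sum>p'\<in>?P - {p}. \<Sum>r\<in>R. of_bool (r (fst p) = snd p \<and> r (fst p') = snd p') :: real"
  have common: "(\<Sum>r\<in>R. of_bool (r (fst p) = snd p \<and> r (fst p') = snd p') :: real)
      \<le> of_bool (\<delta> (fst p) (fst p') = \<delta> (snd p) (snd p'))"
    if p: "p \<in> ?P" and p': "p' \<in> ?P - {p}" for p p'
  proof -
    let ?C = "{r \<in> R. r (fst p) = snd p \<and> r (fst p') = snd p'}"
    have card: "(\<Sum>r\<in>R. of_bool (r (fst p) = snd p \<and> r (fst p') = snd p') :: real) = card ?C"
      using assms(2) by (simp add: sum_of_bool_eq Int_def del: of_bool_conj)
    show ?thesis
    proof (cases "?C = {}")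
      case True
      thus ?thesis unfolding card True by simp
    next
      case False
      then obtain r where r: "r \<in> ?C" by auto
      hence inR: "r \<in> R" and rp: "r (fst p) = snd p" "r (fst p') = snd p'" by blast+
      have ne: "fst p \<noteq> fst p'"
      proof
        assume "fst p = fst p'"
        hence "p = p'" using rp by (metis prod.collapse)
        thus False using p' by blast
      qed
      have U: "fst p \<in> U" "fst p' \<in> U"
        using p DiffD1[OF p'] unfolding mem_Times_iff by iprover+
      have "s = r" if "s \<in> ?C" for s
        using that rp by (intro rigid[OF _ inR U ne]) (elim CollectE conjE, simp only:)+
      hence "?C = {r}" using r by blast
      moreover have "\<delta> (fst p) (fst p') = \<delta> (snd p) (snd p')"
        using isometry[OF inR U] unfolding rp by simp
      ultimately show ?thesis unfolding card by simp
    qed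
  qed
  have "?S \<le> (\<Sum>p\<in>?P. \<Sum>p'\<in>?P - {p}. of_bool (\<delta> (fst p) (fst p') = \<delta> (snd p) (snd p')))"
    by (intro sum_mono common)
  also have "\<dots> \<le> (\<Sum>p\<in>?P. \<Sum>p'\<in>?P. of_bool (\<delta> (fst p) (fst p') = \<delta> (snd p) (snd p')))"
    using assms(1) by (intro sum_mono sum_mono2) auto
  also have "\<dots> = (\<Sum>a\<in>U. \<Sum>c\<in>U. \<Sum>b\<in>U. \<Sum>d\<in>U. of_bool (\<delta> a b = \<delta> c d))"
    by (simp add: sum.cartesian_product')
  finally have S: "?S \<le> \<dots>" .
  have "I\<^sup>2 \<le> card R * (I + ?S)"
    unfolding I_def
    using incidence_square_le[of ?P R "\<lambda>p r. r (fst p) = snd p"] assms(1,2) by simp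
  also have "\<dots> \<le> card R * (I + (\<Sum>a\<in>U. \<Sum>c\<in>U. \<Sum>b\<in>U. \<Sum>d\<in>U. of_bool (\<delta> a b = \<delta> c d)))"
    using S by (intro mult_left_mono add_left_mono) auto
  finally show ?thesis .
qed

text \<open>
  If \<open>I\<close> is at most the energy then \<open>I\<close> is \<open>O(m\<^bsup>1/2\<^esup> n\<^bsup>7/4\<^esup>)\<close>, which is the weighted geometric mean of
  \<open>n\<^sup>2 m\<^bsup>2/5\<^esup>\<close> and \<open>m\<^bsup>6/5\<^esup>\<close> with weights \<open>7/8\<close> and \<open>1/8\<close>; the two terms balance at \<open>m = n\<^bsup>5/2\<^esup>\<close>.
  Otherwise \<open>I \<le> 2 m\<close>.
\<close>

lemma incidence_exponents:
  fixes I :: real and m n :: nat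
  assumes "I\<^sup>2 \<le> m * (I + sqrt 3 * n powr (7/2))"
  shows "I \<le> 2 * (real n ^ 2 * m powr (2/5) + m powr (6/5))"
proof (cases "m = 0")
  case True
  thus ?thesis using assms by simp
next
  case m: False
  let ?Q = "sqrt 3 * real n powr (7/2)"
  have pos: "0 \<le> real n ^ 2 * m powr (2/5)" by simp
  show ?thesis
  proof (cases "I \<le> ?Q")
    case False
    have "0 < I" using False by (smt (verit) powr_ge_zero mult_nonneg_nonneg real_sqrt_ge_zero)
    have "I * I \<le> m * (2 * I)"
      using assms False mult_left_mono[of "I + ?Q" "2 * I" m] by (simp add: power2_eq_square)
    hence "I \<le> 2 * real m"
      using \<open>0 < I\<close> by simp
    moreover have "real m \<le> m powr (6/5)"
      using m powr_mono[of 1 "6/5" m] by simp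
    ultimately show ?thesis using pos by argo
  next
    case True
    have "I\<^sup>2 \<le> m * (2 * ?Q)"
      using assms True mult_left_mono[of "I + ?Q" "2 * ?Q" m] by simp
    also have "\<dots> \<le> m * (4 * real n powr (7/2))"
      using real_sqrt_le_mono[of 3 4] by (intro mult_left_mono) (auto intro!: mult_right_mono)
    also have "\<dots> = (2 * (m powr (1/2) * n powr (7/4)))\<^sup>2"
      using m powr_add[of m "1/2" "1/2"] powr_add[of n "7/4" "7/4"]
      by (simp add: power_mult_distrib power2_eq_square mult_ac)
    finally have I: "I \<le> 2 * (m powr (1/2) * n powr (7/4))"
      by (rule power2_le_imp_le) simp
    show ?thesis
    proof (cases "real m \<le> n powr (5/2)")
      case True
      have n: "n \<noteq> 0" using True m by (cases n) auto
      have "real m powr (1/10) \<le> (n powr (5/2)) powr (1/10)"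
        using True by (intro powr_mono2) auto
      hence "m powr (2/5) * real m powr (1/10) * n powr (7/4)
          \<le> m powr (2/5) * real n powr (1/4) * n powr (7/4)"
        by (intro mult_right_mono mult_left_mono) (auto simp: powr_powr)
      also have "\<dots> = real n ^ 2 * m powr (2/5)"
        using n powr_add[of n "1/4" "7/4"] by simp
      also have "m powr (2/5) * real m powr (1/10) = m powr (1/2)"
        using powr_add[of m "2/5" "1/10"] by simp
      finally have "m powr (1/2) * n powr (7/4) \<le> real n ^ 2 * m powr (2/5)" .
      thus ?thesis using I powr_ge_zero[of m "6/5"] by argo
    next
      case False
      have "(n powr (5/2)) powr (7/10) \<le> real m powr (7/10)"
        using False by (intro powr_mono2) auto
      hence "m powr (1/2) * n powr (7/4) \<le> m powr (1/2) * m powr (7/10)"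
        by (intro mult_left_mono) (auto simp: powr_powr)
      also have "\<dots> = m powr (6/5)"
        using m by (simp add: powr_add[symmetric])
      finally show ?thesis using I pos by argo
    qed
  qed
qed

section \<open>Circles and motions over a field without isotropic vectors\<close>

text \<open>
  A nontrivial zero of \<open>x\<^sup>2 + y\<^sup>2\<close> is a square root \<open>x / y\<close> of \<open>-1\<close>. Such a root has order four in the
  multiplicative group, whose order \<open>q - 1\<close> is \<open>2\<close> modulo \<open>4\<close>.
\<close>

lemma (in field) sum_of_squares_anisotropic:
  assumes fin: "finite (carrier R)" and mod4: "card (carrier R) mod 4 = 3"
    and x: "x \<in> carrier R" and y: "y \<in> carrier R" and sum: "x \<otimes> x \<oplus> y \<otimes> y = \<zero>"
  shows "x = \<zero> \<and> y = \<zero>"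
proof -
  obtain k where k: "card (carrier R) = Suc (2 * (2 * k + 1))"
  proof
    show "card (carrier R) = Suc (2 * (2 * (card (carrier R) div 4) + 1))"
      using mod4 by presburger
  qed
  have y0: "y = \<zero>"
  proof (rule ccontr)
    assume "y \<noteq> \<zero>"
    hence y': "y \<in> Units R" using y field_Units by auto
    define i where "i = x \<otimes> inv y"
    have iy: "inv y \<in> carrier R" "y \<otimes> inv y = \<one>" using y' by auto
    have i: "i \<in> carrier R" using x iy by (simp add: i_def)
    have "i \<otimes> i \<oplus> (y \<otimes> inv y) \<otimes> (y \<otimes> inv y) = (x \<otimes> x \<oplus> y \<otimes> y) \<otimes> (inv y \<otimes> inv y)"
      using x y iy(1) unfolding i_def by algebra
    hence "i \<otimes> i \<oplus> \<one> = \<zero>" using sum iy by simp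
    hence ii: "i \<otimes> i = \<ominus> \<one>" using i by (metis minus_equality m_closed one_closed)
    have i0: "i \<noteq> \<zero>" using ii iy(2) by (metis l_null minus_minus minus_zero one_closed one_not_zero zero_closed)
    have sq: "i [^] (2::nat) = \<ominus> \<one>" using ii i by (simp add: numeral_2_eq_2)
    have m1: "(\<ominus> \<one>) [^] (2::nat) = \<one>" by (simp add: numeral_2_eq_2 l_minus r_minus)
    \<comment> \<open>The power of \<open>i\<close> to the group order \<open>2 * (2 * k + 1)\<close> is \<open>\<one>\<close>; it is also an odd power of
      \<open>i [^] 2 = \<ominus> \<one>\<close>. Hence \<open>\<one> = \<ominus> \<one>\<close>, impossible with an odd number of elements.\<close>
    have "i [^] order (mult_of R) = \<one>"
      using group.pow_order_eq_1[OF field_mult_group, of i] i i0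
      by (simp add: nat_pow_mult_of)
    moreover have "order (mult_of R) = 2 * (2 * k + 1)"
      using k fin by (simp add: order_def)
    ultimately have "i [^] (2 * (2 * k + 1)) = \<one>" by simp
    hence "(\<ominus> \<one>) [^] (2 * k + 1) = \<one>" using i sq by (metis nat_pow_pow)
    moreover have "(\<ominus> \<one>) [^] (2 * k + 1) = \<ominus> \<one>"
      using m1 by (simp add: nat_pow_mult[symmetric] nat_pow_pow[symmetric])
    ultimately have two: "\<one> \<oplus> \<one> = \<zero>" by (metis r_neg one_closed)
    have "[order (add_monoid R)] \<cdot> \<one> = \<zero>"
      using group.pow_order_eq_1[OF a_group, of \<one>] by (simp add: add_pow_def)
    hence "[Suc (2 * (2 * k + 1))] \<cdot> \<one> = \<zero>" using k by (simp add: order_def)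
    moreover have "[(2 * j)] \<cdot> \<one> = \<zero>" for j :: nat
    proof -
      have "[(2::nat)] \<cdot> \<one> = \<zero>" using two by (simp add: numeral_2_eq_2)
      thus ?thesis using add.nat_pow_pow[of \<one> j 2] by simp
    qed
    moreover have "[Suc (2 * (2 * k + 1))] \<cdot> \<one> = [(2 * (2 * k + 1))] \<cdot> \<one> \<oplus> \<one>"
      by (rule add.nat_pow_Suc)
    ultimately have "\<one> = \<zero>" by (metis l_zero one_closed)
    thus False by simp
  qed
  hence "x \<otimes> x = \<zero>" using sum x by simp
  thus ?thesis using y0 x integral_iff by auto
qed

text \<open>
  Everything that the geometry uses about the field: no nonzero vector is isotropic. In particular
  the characteristic is not two, since otherwise \<open>(\<one>, \<one>)\<close> would be isotropic.
\<close>

locale euclidean_plane = field F for F :: "'a ring" (structure) +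
  assumes anisotropic: "x \<in> carrier F \<Longrightarrow> y \<in> carrier F \<Longrightarrow> x \<otimes> x \<oplus> y \<otimes> y = \<zero> \<Longrightarrow> x = \<zero> \<and> y = \<zero>"
begin

lemma double_cancel:
  assumes "x \<in> carrier F" "x \<oplus> x = \<zero>"
  shows "x = \<zero>"
proof -
  have "\<one> \<oplus> \<one> \<noteq> \<zero>" using anisotropic[of \<one> \<one>] by auto
  moreover have "(\<one> \<oplus> \<one>) \<otimes> x = \<zero>" using assms by (simp add: l_distr)
  ultimately show ?thesis using assms(1) integral_iff by blast
qed

fun sqdist :: "'a vec2 \<Rightarrow> 'a vec2 \<Rightarrow> 'a" where
  "sqdist (x, y) (x', y') = (x' \<ominus> x) \<otimes> (x' \<ominus> x) \<oplus> (y' \<ominus> y) \<otimes> (y' \<ominus> y)"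

lemma add_left_imp_eq:
  assumes "s \<in> carrier F" "x \<in> carrier F" "y \<in> carrier F" "s \<oplus> x = s \<oplus> y"
  shows "x = y"
  using assms by (simp add: a_comm[of s])

text \<open>
  The difference of two vectors of equal norm is orthogonal to their sum.
\<close>

lemma norm_add_eq_imp:
  assumes "x \<in> carrier F" "y \<in> carrier F" "p \<in> carrier F" "q \<in> carrier F"
    and "(x \<oplus> p) \<otimes> (x \<oplus> p) \<oplus> (y \<oplus> q) \<otimes> (y \<oplus> q) = x \<otimes> x \<oplus> y \<otimes> y"
  shows "p \<otimes> (x \<oplus> x \<oplus> p) \<oplus> q \<otimes> (y \<oplus> y \<oplus> q) = \<zero>"
proof -
  have "(x \<otimes> x \<oplus> y \<otimes> y) \<oplus> (p \<otimes> (x \<oplus> x \<oplus> p) \<oplus> q \<otimes> (y \<oplus> y \<oplus> q))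
      = (x \<oplus> p) \<otimes> (x \<oplus> p) \<oplus> (y \<oplus> q) \<otimes> (y \<oplus> q)"
    using assms(1-4) by algebra
  also have "\<dots> = (x \<otimes> x \<oplus> y \<otimes> y) \<oplus> \<zero>"
    using assms by simp
  finally show ?thesis
    by (rule add_left_imp_eq[rotated 3]) (intro a_closed m_closed zero_closed assms)+
qed

text \<open>
  Two circles with centres at \<open>0\<close> and \<open>w\<close> pass through \<open>f\<close> and through \<open>f + (p, q)\<close>. Subtracting
  their equations shows that \<open>(p, q)\<close> is orthogonal to \<open>w\<close>, so it is a multiple of \<open>(- w2, w1)\<close>, and
  the equation of one circle then leaves a single nonzero choice of the multiple. It is stated
  without division, multiplied by the norm of \<open>w\<close>; what matters is that the right-hand sides do
  not contain \<open>p\<close> and \<open>q\<close>.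
\<close>

lemma second_intersection:
  assumes carr: "f1 \<in> carrier F" "f2 \<in> carrier F" "w1 \<in> carrier F" "w2 \<in> carrier F"
      "p \<in> carrier F" "q \<in> carrier F"
    and eq1: "(f1 \<oplus> p) \<otimes> (f1 \<oplus> p) \<oplus> (f2 \<oplus> q) \<otimes> (f2 \<oplus> q) = f1 \<otimes> f1 \<oplus> f2 \<otimes> f2"
    and eq2: "(f1 \<ominus> w1 \<oplus> p) \<otimes> (f1 \<ominus> w1 \<oplus> p) \<oplus> (f2 \<ominus> w2 \<oplus> q) \<otimes> (f2 \<ominus> w2 \<oplus> q)
      = (f1 \<ominus> w1) \<otimes> (f1 \<ominus> w1) \<oplus> (f2 \<ominus> w2) \<otimes> (f2 \<ominus> w2)"
    and w: "(w1, w2) \<noteq> (\<zero>, \<zero>)" and pq: "(p, q) \<noteq> (\<zero>, \<zero>)"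
  defines "s \<equiv> w2 \<otimes> f1 \<ominus> w1 \<otimes> f2"
  shows "(w1 \<otimes> w1 \<oplus> w2 \<otimes> w2) \<otimes> p = \<ominus> (w2 \<otimes> (s \<oplus> s))"
    and "(w1 \<otimes> w1 \<oplus> w2 \<otimes> w2) \<otimes> q = w1 \<otimes> (s \<oplus> s)"
proof -
  \<comment> \<open>Once \<open>d = \<zero>\<close> is known, \<open>t\<close> is the norm of \<open>w\<close> times the factor by which \<open>(p, q)\<close> is a
    multiple of \<open>(\<ominus> w2, w1)\<close>; the claim becomes \<open>t = s \<oplus> s\<close>.\<close>
  define t where "t = q \<otimes> w1 \<ominus> p \<otimes> w2"
  define d where "d = p \<otimes> w1 \<oplus> q \<otimes> w2"
  define g where "g = p \<otimes> f1 \<oplus> q \<otimes> f2"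
  define h where "h = w1 \<otimes> f1 \<oplus> w2 \<otimes> f2"
  define N where "N = w1 \<otimes> w1 \<oplus> w2 \<otimes> w2"
  define M where "M = p \<otimes> p \<oplus> q \<otimes> q"
  have closed: "s \<in> carrier F" "t \<in> carrier F" "d \<in> carrier F" "g \<in> carrier F"
      "h \<in> carrier F" "N \<in> carrier F" "M \<in> carrier F"
    unfolding s_def t_def d_def g_def h_def N_def M_def by (intro a_closed m_closed minus_closed carr)+
  have N: "N \<noteq> \<zero>" unfolding N_def using anisotropic carr w by blast
  have e1: "p \<otimes> (f1 \<oplus> f1 \<oplus> p) \<oplus> q \<otimes> (f2 \<oplus> f2 \<oplus> q) = \<zero>"
    by (rule norm_add_eq_imp[OF _ _ _ _ eq1]) (intro carr)+
  have e2: "p \<otimes> (f1 \<ominus> w1 \<oplus> (f1 \<ominus> w1) \<oplus> p) \<oplus> q \<otimes> (f2 \<ominus> w2 \<oplus> (f2 \<ominus> w2) \<oplus> q) = \<zero>"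
    by (rule norm_add_eq_imp[OF _ _ _ _ eq2]) (intro minus_closed carr)+
  have "d \<oplus> d \<oplus> (p \<otimes> (f1 \<ominus> w1 \<oplus> (f1 \<ominus> w1) \<oplus> p) \<oplus> q \<otimes> (f2 \<ominus> w2 \<oplus> (f2 \<ominus> w2) \<oplus> q))
      = p \<otimes> (f1 \<oplus> f1 \<oplus> p) \<oplus> q \<otimes> (f2 \<oplus> f2 \<oplus> q)"
    unfolding d_def using carr by algebra
  hence "d \<oplus> d = \<zero>"
    unfolding e1 e2 using closed by simp
  hence d: "d = \<zero>" by (rule double_cancel[OF closed(3)])
  \<comment> \<open>Lagrange's identity, once for the norm of \<open>(p, q)\<close> and once for its product with \<open>f\<close>.\<close>
  have "t \<otimes> t \<oplus> d \<otimes> d = N \<otimes> M"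
    unfolding t_def d_def N_def M_def using carr by algebra
  hence tt: "t \<otimes> t = N \<otimes> M"
    unfolding d using closed by simp
  have "t \<otimes> s \<oplus> N \<otimes> g = d \<otimes> h"
    unfolding t_def s_def d_def N_def g_def h_def using carr by algebra
  hence ts: "t \<otimes> s \<oplus> N \<otimes> g = \<zero>"
    unfolding d using closed by simp
  have "M \<oplus> (g \<oplus> g) = p \<otimes> (f1 \<oplus> f1 \<oplus> p) \<oplus> q \<otimes> (f2 \<oplus> f2 \<oplus> q)"
    unfolding M_def g_def using carr by algebra
  hence M: "M \<oplus> (g \<oplus> g) = \<zero>" unfolding e1 .
  have "t \<otimes> (t \<ominus> (s \<oplus> s))
      = t \<otimes> t \<ominus> (t \<otimes> s \<oplus> N \<otimes> g) \<ominus> (t \<otimes> s \<oplus> N \<otimes> g) \<oplus> N \<otimes> (M \<oplus> (g \<oplus> g)) \<ominus> N \<otimes> M"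
    using closed by algebra
  also have "\<dots> = \<zero>"
    unfolding ts M tt using closed by (simp add: a_minus_def r_neg)
  finally have "t = \<zero> \<or> t \<ominus> (s \<oplus> s) = \<zero>"
    by (rule integral) (intro minus_closed a_closed closed)+
  moreover have "N \<otimes> p = w1 \<otimes> d \<ominus> w2 \<otimes> t"
    unfolding N_def d_def t_def using carr by algebra
  hence Np: "N \<otimes> p = \<ominus> (w2 \<otimes> t)"
    unfolding d using carr closed by (simp add: a_minus_def)
  moreover have "N \<otimes> q = w2 \<otimes> d \<oplus> w1 \<otimes> t"
    unfolding N_def d_def t_def using carr by algebra
  hence Nq: "N \<otimes> q = w1 \<otimes> t"
    unfolding d using carr closed by simp
  moreover have "t \<noteq> \<zero>"
  proof
    assume "t = \<zero>"
    hence "N \<otimes> p = \<zero>" "N \<otimes> q = \<zero>"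
      unfolding Np Nq using carr by simp_all
    thus False using N carr closed pq integral_iff by auto
  qed
  ultimately have "t = s \<oplus> s" using closed by simp
  thus "(w1 \<otimes> w1 \<oplus> w2 \<otimes> w2) \<otimes> p = \<ominus> (w2 \<otimes> (s \<oplus> s))"
    and "(w1 \<otimes> w1 \<oplus> w2 \<otimes> w2) \<otimes> q = w1 \<otimes> (s \<oplus> s)"
    using Np Nq unfolding N_def by simp_all
qed

lemma circles_meet_again_once:
  assumes "a \<in> plane F" "a' \<in> plane F" "b \<in> plane F" "d \<in> plane F" "e \<in> plane F"
    and "a \<noteq> a'" "d \<noteq> b" "e \<noteq> b"
    and "sqdist a b = sqdist a d" "sqdist a' b = sqdist a' d"
    and "sqdist a b = sqdist a e" "sqdist a' b = sqdist a' e"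
  shows "d = e"
proof -
  obtain a1 a2 a1' a2' b1 b2 d1 d2 e1 e2 where
    pts: "a = (a1, a2)" "a' = (a1', a2')" "b = (b1, b2)" "d = (d1, d2)" "e = (e1, e2)"
    by fastforce
  have carr: "a1 \<in> carrier F" "a2 \<in> carrier F" "a1' \<in> carrier F" "a2' \<in> carrier F"
    "b1 \<in> carrier F" "b2 \<in> carrier F" "d1 \<in> carrier F" "d2 \<in> carrier F"
    "e1 \<in> carrier F" "e2 \<in> carrier F"
    using assms(1-5) by (auto simp: pts plane_def)
  let ?w1 = "a1' \<ominus> a1" and ?w2 = "a2' \<ominus> a2"
  let ?f1 = "b1 \<ominus> a1" and ?f2 = "b2 \<ominus> a2"
  let ?s = "?w2 \<otimes> ?f1 \<ominus> ?w1 \<otimes> ?f2"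
  have w: "(?w1, ?w2) \<noteq> (\<zero>, \<zero>)" using assms(6) carr by (auto simp: pts)
  have key: "(?w1 \<otimes> ?w1 \<oplus> ?w2 \<otimes> ?w2) \<otimes> (x \<ominus> b1) = \<ominus> (?w2 \<otimes> (?s \<oplus> ?s)) \<and>
      (?w1 \<otimes> ?w1 \<oplus> ?w2 \<otimes> ?w2) \<otimes> (y \<ominus> b2) = ?w1 \<otimes> (?s \<oplus> ?s)"
    if xy: "x \<in> carrier F" "y \<in> carrier F" "(x, y) \<noteq> (b1, b2)"
      "sqdist a b = sqdist a (x, y)" "sqdist a' b = sqdist a' (x, y)" for x y
  proof -
    have shift: "?f1 \<oplus> (x \<ominus> b1) = x \<ominus> a1" "?f2 \<oplus> (y \<ominus> b2) = y \<ominus> a2"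
      "b1 \<ominus> a1' \<oplus> (x \<ominus> b1) = x \<ominus> a1'" "b2 \<ominus> a2' \<oplus> (y \<ominus> b2) = y \<ominus> a2'"
      "?f1 \<ominus> ?w1 = b1 \<ominus> a1'" "?f2 \<ominus> ?w2 = b2 \<ominus> a2'"
      using carr xy(1,2) by algebra+
    show ?thesis
      using second_intersection[of ?f1 ?f2 ?w1 ?w2 "x \<ominus> b1" "y \<ominus> b2"] carr xy w
      by (simp add: shift pts)
  qed
  have N: "?w1 \<otimes> ?w1 \<oplus> ?w2 \<otimes> ?w2 \<noteq> \<zero>" using anisotropic[of ?w1 ?w2] carr w by auto
  have "(?w1 \<otimes> ?w1 \<oplus> ?w2 \<otimes> ?w2) \<otimes> (d1 \<ominus> b1) = (?w1 \<otimes> ?w1 \<oplus> ?w2 \<otimes> ?w2) \<otimes> (e1 \<ominus> b1)"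
    "(?w1 \<otimes> ?w1 \<oplus> ?w2 \<otimes> ?w2) \<otimes> (d2 \<ominus> b2) = (?w1 \<otimes> ?w1 \<oplus> ?w2 \<otimes> ?w2) \<otimes> (e2 \<ominus> b2)"
    using key[of d1 d2] key[of e1 e2] assms(7-12) carr by (auto simp: pts)
  hence "d1 \<ominus> b1 = e1 \<ominus> b1" "d2 \<ominus> b2 = e2 \<ominus> b2"
    using N carr by (simp_all add: m_lcancel)
  thus "d = e" using carr by (simp add: pts a_minus_def)
qed

text \<open>
  A rotation is multiplication by the element \<open>a + c i\<close> of norm one in the quadratic extension by
  a square root \<open>i\<close> of \<open>-1\<close>.
\<close>

lemma SO2_cases:
  assumes "g \<in> SO2 F"
  obtains a c where "a \<in> carrier F" "c \<in> carrier F" "g = ((a, \<ominus> c), (c, a))"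
    "a \<otimes> a \<oplus> c \<otimes> c = \<one>"
proof -
  obtain a b c d where g: "g = ((a, b), (c, d))" by (metis surj_pair)
  have carr: "a \<in> carrier F" "b \<in> carrier F" "c \<in> carrier F" "d \<in> carrier F"
    and norm: "a \<otimes> a \<oplus> c \<otimes> c = \<one>" and orth: "a \<otimes> b \<oplus> c \<otimes> d = \<zero>"
    and det: "a \<otimes> d \<ominus> b \<otimes> c = \<one>"
    using assms by (auto simp: SO2_def g matrices_def plane_def mat_id_def)
  have "d \<otimes> (a \<otimes> a \<oplus> c \<otimes> c) = a \<otimes> (a \<otimes> d \<ominus> b \<otimes> c) \<oplus> c \<otimes> (a \<otimes> b \<oplus> c \<otimes> d)"
    using carr by algebra
  hence "d = a" unfolding norm orth det using carr by simp
  moreover have "b \<otimes> (a \<otimes> a \<oplus> c \<otimes> c) = a \<otimes> (a \<otimes> b \<oplus> c \<otimes> d) \<oplus> (\<ominus> c) \<otimes> (a \<otimes> d \<ominus> b \<otimes> c)"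
    using carr by algebra
  hence "b = \<ominus> c" unfolding norm orth det using carr by simp
  ultimately show thesis using that carr norm g by blast
qed

lemma SF2_cases:
  assumes "r \<in> SF2 F"
  obtains a c z1 z2 where "a \<in> carrier F" "c \<in> carrier F" "z1 \<in> carrier F" "z2 \<in> carrier F"
    "a \<otimes> a \<oplus> c \<otimes> c = \<one>" "r = rigid_motion F ((a, \<ominus> c), (c, a)) (z1, z2)"
proof -
  obtain g z where gz: "g \<in> SO2 F" "z \<in> plane F" "r = rigid_motion F g z"
    using assms by (auto simp: SF2_def)
  obtain z1 z2 where "z = (z1, z2)" "z1 \<in> carrier F" "z2 \<in> carrier F"
    using gz(2) by (auto simp: plane_def)
  with SO2_cases[OF gz(1)] gz(3) that show thesis by metis
qed

lemma rigid_motion_apply: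
  assumes "a \<in> carrier F" "b \<in> carrier F" "c \<in> carrier F" "d \<in> carrier F"
    and "x \<in> carrier F" "y \<in> carrier F"
  shows "rigid_motion F ((a, b), (c, d)) z (x, y) = vec_add F (mat_vec F ((a, b), (c, d)) (x, y)) z"
  using assms by (simp add: rigid_motion_def compose_def translation_def linear_motion_def plane_def)

lemma affine_form_difference:
  assumes "a \<in> carrier F" "b \<in> carrier F" "z \<in> carrier F" "x \<in> carrier F" "y \<in> carrier F"
    "x' \<in> carrier F" "y' \<in> carrier F"
  shows "(a \<otimes> x' \<oplus> b \<otimes> y' \<oplus> z) \<ominus> (a \<otimes> x \<oplus> b \<otimes> y \<oplus> z) = a \<otimes> (x' \<ominus> x) \<oplus> b \<otimes> (y' \<ominus> y)"
  using assms by algebra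

lemma SF2_isometry:
  assumes "r \<in> SF2 F" "u \<in> plane F" "v \<in> plane F"
  shows "sqdist (r u) (r v) = sqdist u v"
proof -
  obtain a c z1 z2 where carr: "a \<in> carrier F" "c \<in> carrier F" "z1 \<in> carrier F" "z2 \<in> carrier F"
    and norm: "a \<otimes> a \<oplus> c \<otimes> c = \<one>" and r: "r = rigid_motion F ((a, \<ominus> c), (c, a)) (z1, z2)"
    using SF2_cases[OF assms(1)] .
  obtain u1 u2 v1 v2 where uv: "u = (u1, u2)" "v = (v1, v2)" by fastforce
  have uvc: "u1 \<in> carrier F" "u2 \<in> carrier F" "v1 \<in> carrier F" "v2 \<in> carrier F"
    using assms by (auto simp: plane_def uv)
  define w1 w2 where "w1 = v1 \<ominus> u1" and "w2 = v2 \<ominus> u2"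
  have w: "w1 \<in> carrier F" "w2 \<in> carrier F"
    using uvc by (simp_all add: w1_def w2_def)
  have "sqdist (r u) (r v) = (a \<otimes> w1 \<oplus> \<ominus> c \<otimes> w2) \<otimes> (a \<otimes> w1 \<oplus> \<ominus> c \<otimes> w2)
      \<oplus> (c \<otimes> w1 \<oplus> a \<otimes> w2) \<otimes> (c \<otimes> w1 \<oplus> a \<otimes> w2)"
    unfolding uv r w1_def w2_def using carr uvc
    by (simp only: rigid_motion_apply a_inv_closed mat_vec.simps vec_add.simps sqdist.simps
        affine_form_difference)
  also have "\<dots> = (a \<otimes> a \<oplus> c \<otimes> c) \<otimes> (w1 \<otimes> w1 \<oplus> w2 \<otimes> w2)"
    using carr(1,2) w by algebra
  also have "\<dots> = sqdist u v"
    unfolding norm uv sqdist.simps w1_def[symmetric] w2_def[symmetric] using w by simp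
  finally show ?thesis .
qed

text \<open>
  Multiplying the rotated vector by the conjugate of \<open>x + y i\<close>: the real and the imaginary part.
\<close>

lemma recover_rotation:
  assumes "a \<in> carrier F" "c \<in> carrier F" "x \<in> carrier F" "y \<in> carrier F"
  shows "(x \<otimes> x \<oplus> y \<otimes> y) \<otimes> a = x \<otimes> (a \<otimes> x \<oplus> \<ominus> c \<otimes> y) \<oplus> y \<otimes> (c \<otimes> x \<oplus> a \<otimes> y)"
    and "(x \<otimes> x \<oplus> y \<otimes> y) \<otimes> c = x \<otimes> (c \<otimes> x \<oplus> a \<otimes> y) \<ominus> y \<otimes> (a \<otimes> x \<oplus> \<ominus> c \<otimes> y)"
  using assms by algebra+

text \<open>
  A motion turns the vector from \<open>u\<close> to \<open>v\<close> into the vector between the images. Dividing the second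
  vector by the first, as in the complex plane, recovers the rotation; the division is possible as
  the first vector is not isotropic.
\<close>

lemma SF2_determined:
  assumes "r \<in> SF2 F" "r' \<in> SF2 F" "u \<in> plane F" "v \<in> plane F" "u \<noteq> v"
    and "r u = r' u" "r v = r' v"
  shows "r = r'"
proof -
  obtain a c z1 z2 where carr: "a \<in> carrier F" "c \<in> carrier F" "z1 \<in> carrier F" "z2 \<in> carrier F"
    and r: "r = rigid_motion F ((a, \<ominus> c), (c, a)) (z1, z2)"
    using SF2_cases[OF assms(1)] .
  obtain a' c' z1' z2' where carr': "a' \<in> carrier F" "c' \<in> carrier F" "z1' \<in> carrier F" "z2' \<in> carrier F"
    and r': "r' = rigid_motion F ((a', \<ominus> c'), (c', a')) (z1', z2')"
    using SF2_cases[OF assms(2)] .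
  obtain u1 u2 v1 v2 where uv: "u = (u1, u2)" "v = (v1, v2)" by fastforce
  have uvc: "u1 \<in> carrier F" "u2 \<in> carrier F" "v1 \<in> carrier F" "v2 \<in> carrier F"
    using assms by (auto simp: plane_def uv)
  let ?X = "\<lambda>x y a c z. a \<otimes> x \<oplus> (\<ominus> c) \<otimes> y \<oplus> z"
  let ?Y = "\<lambda>x y a c z. c \<otimes> x \<oplus> a \<otimes> y \<oplus> z"
  have X: "?X u1 u2 a c z1 = ?X u1 u2 a' c' z1'" "?X v1 v2 a c z1 = ?X v1 v2 a' c' z1'"
    and Y: "?Y u1 u2 a c z2 = ?Y u1 u2 a' c' z2'" "?Y v1 v2 a c z2 = ?Y v1 v2 a' c' z2'"
    using assms(6,7) carr carr' uvc by (simp_all add: r r' uv rigid_motion_apply)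
  let ?w1 = "v1 \<ominus> u1" and ?w2 = "v2 \<ominus> u2"
  have N: "?w1 \<otimes> ?w1 \<oplus> ?w2 \<otimes> ?w2 \<noteq> \<zero>"
    using anisotropic[of ?w1 ?w2] assms(5) uvc by (auto simp: uv)
  have cos: "(?w1 \<otimes> ?w1 \<oplus> ?w2 \<otimes> ?w2) \<otimes> a
      = ?w1 \<otimes> (?X v1 v2 a c z1 \<ominus> ?X u1 u2 a c z1) \<oplus> ?w2 \<otimes> (?Y v1 v2 a c z2 \<ominus> ?Y u1 u2 a c z2)"
    and sin: "(?w1 \<otimes> ?w1 \<oplus> ?w2 \<otimes> ?w2) \<otimes> c
      = ?w1 \<otimes> (?Y v1 v2 a c z2 \<ominus> ?Y u1 u2 a c z2) \<ominus> ?w2 \<otimes> (?X v1 v2 a c z1 \<ominus> ?X u1 u2 a c z1)"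
    if ac: "a \<in> carrier F" "c \<in> carrier F" "z1 \<in> carrier F" "z2 \<in> carrier F" for a c z1 z2
  proof -
    have w: "?w1 \<in> carrier F" "?w2 \<in> carrier F" using uvc by simp_all
    show "(?w1 \<otimes> ?w1 \<oplus> ?w2 \<otimes> ?w2) \<otimes> a
        = ?w1 \<otimes> (?X v1 v2 a c z1 \<ominus> ?X u1 u2 a c z1) \<oplus> ?w2 \<otimes> (?Y v1 v2 a c z2 \<ominus> ?Y u1 u2 a c z2)"
      unfolding affine_form_difference[OF ac(1) a_inv_closed[OF ac(2)] ac(3) uvc]
        affine_form_difference[OF ac(2,1,4) uvc]
      using ac(1,2) w by (rule recover_rotation(1))
    show "(?w1 \<otimes> ?w1 \<oplus> ?w2 \<otimes> ?w2) \<otimes> c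
        = ?w1 \<otimes> (?Y v1 v2 a c z2 \<ominus> ?Y u1 u2 a c z2) \<ominus> ?w2 \<otimes> (?X v1 v2 a c z1 \<ominus> ?X u1 u2 a c z1)"
      unfolding affine_form_difference[OF ac(1) a_inv_closed[OF ac(2)] ac(3) uvc]
        affine_form_difference[OF ac(2,1,4) uvc]
      using ac(1,2) w by (rule recover_rotation(2))
  qed
  have Nc: "?w1 \<otimes> ?w1 \<oplus> ?w2 \<otimes> ?w2 \<in> carrier F"
    by (intro a_closed m_closed minus_closed uvc)
  have eq: "(?w1 \<otimes> ?w1 \<oplus> ?w2 \<otimes> ?w2) \<otimes> a = (?w1 \<otimes> ?w1 \<oplus> ?w2 \<otimes> ?w2) \<otimes> a'"
    "(?w1 \<otimes> ?w1 \<oplus> ?w2 \<otimes> ?w2) \<otimes> c = (?w1 \<otimes> ?w1 \<oplus> ?w2 \<otimes> ?w2) \<otimes> c'"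
    unfolding cos[OF carr] cos[OF carr'] sin[OF carr] sin[OF carr'] X Y by (rule refl)+
  have ac: "a = a'" "c = c'"
    using m_lcancel[OF N Nc carr(1) carr'(1)] m_lcancel[OF N Nc carr(2) carr'(2)] eq by iprover+
  have "z1 = z1'"
    using X(1) unfolding ac
    by (rule add_left_imp_eq[rotated 3]) (intro a_closed m_closed a_inv_closed carr carr' uvc)+
  moreover have "z2 = z2'"
    using Y(1) unfolding ac
    by (rule add_left_imp_eq[rotated 3]) (intro a_closed m_closed a_inv_closed carr carr' uvc)+
  ultimately show ?thesis using ac r r' by simp
qed

lemma card_circles_meet_le:
  assumes U: "finite U" "U \<subseteq> plane F" and "a \<in> U" "a' \<in> U" "b \<in> U" "a \<noteq> a'"
  shows "card {d \<in> U. sqdist a b = sqdist a d \<and> sqdist a' b = sqdist a' d} \<le> 2"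
proof -
  let ?D = "{d \<in> U. sqdist a b = sqdist a d \<and> sqdist a' b = sqdist a' d}"
  have "d = e" if "d \<in> ?D - {b}" "e \<in> ?D - {b}" for d e
    using that assms by (intro circles_meet_again_once[of a a' b d e]) auto
  hence "card (?D - {b}) \<le> Suc 0"
    using U(1) by (subst card_le_Suc0_iff_eq) auto
  moreover have "card ?D - card {b} \<le> card (?D - {b})"
    by (rule diff_card_le_card_Diff) simp
  moreover have "card {b} = 1" by simp
  ultimately show ?thesis by linarith
qed

lemma incident_imp_apply:
  assumes "incident F p r" "fst p \<in> plane F"
  shows "r (fst p) = snd p"
proof -
  obtain g z where g: "g \<in> SO2 F" "r = rigid_motion F g z" "vec_add F (mat_vec F g (fst p)) z = snd p"
    using assms(1) by (auto simp: incident_def)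
  obtain a c where ac: "a \<in> carrier F" "c \<in> carrier F" "g = ((a, \<ominus> c), (c, a))"
    using SO2_cases[OF g(1)] .
  show ?thesis
    using g(2,3) assms(2) ac by (cases "fst p") (simp add: plane_def rigid_motion_apply)
qed

lemma finite_SF2:
  assumes "finite (carrier F)"
  shows "finite (SF2 F)"
proof -
  have "SO2 F \<subseteq> matrices F" by (auto simp: SO2_def)
  hence "finite (SO2 F)" "finite (plane F)"
    using assms by (auto simp: matrices_def plane_def intro: finite_subset)
  hence "finite ((\<lambda>(g, z). rigid_motion F g z) ` (SO2 F \<times> plane F))" by simp
  thus ?thesis by (rule finite_subset[rotated]) (auto simp: SF2_def)
qed

theorem incidences_le:
  assumes fin: "finite (carrier F)" and U: "U \<subseteq> plane F" and R: "R \<subseteq> SF2 F"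
  shows "real (incidences F (U \<times> U) R)
    \<le> 2 * (real (card (U \<times> U)) * real (card R) powr (2/5) + real (card R) powr (6/5))"
proof -
  have finU: "finite U"
    using finite_subset[OF U] fin by (simp add: plane_def)
  have finR: "finite R"
    using finite_subset[OF R finite_SF2[OF fin]] .
  define I where "I = (\<Sum>r\<in>R. \<Sum>p\<in>U \<times> U. of_bool (r (fst p) = snd p) :: real)"
  define S where "S = {x \<in> (U \<times> U) \<times> R. snd x (fst (fst x)) = snd (fst x)}"
  have "{(p, r). p \<in> U \<times> U \<and> r \<in> R \<and> incident F p r} \<subseteq> S"
    using U incident_imp_apply by (auto simp: S_def)
  hence "incidences F (U \<times> U) R \<le> card S"
    unfolding incidences_def using finU finR by (intro card_mono) (auto simp: S_def)
  moreover have "real (card S) = I"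
  proof -
    have "real (card S) = (\<Sum>x\<in>(U \<times> U) \<times> R. of_bool (snd x (fst (fst x)) = snd (fst x)))"
      using finU finR by (simp add: S_def sum_of_bool_eq Int_def)
    also have "\<dots> = (\<Sum>p\<in>U \<times> U. \<Sum>r\<in>R. of_bool (r (fst p) = snd p))"
      unfolding sum.cartesian_product by (simp add: case_prod_unfold)
    also have "\<dots> = I"
      unfolding I_def by (rule sum.swap)
    finally show ?thesis .
  qed
  moreover have "I \<le> 2 * (real (card U) ^ 2 * real (card R) powr (2/5) + real (card R) powr (6/5))"
  proof (rule incidence_exponents)
    have "(\<Sum>a\<in>U. \<Sum>c\<in>U. \<Sum>b\<in>U. \<Sum>d\<in>U. of_bool (sqdist a b = sqdist c d) :: real)
        \<le> sqrt 3 * card U powr (7/2)"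
      using card_circles_meet_le[OF finU U] by (intro distance_energy_le finU)
    moreover have "I\<^sup>2 \<le> card R *
        (I + (\<Sum>a\<in>U. \<Sum>c\<in>U. \<Sum>b\<in>U. \<Sum>d\<in>U. of_bool (sqdist a b = sqdist c d)))"
      unfolding I_def using finU finR
    proof (rule motion_incidences_square_le)
      show "sqdist (r u) (r v) = sqdist u v" if "r \<in> R" "u \<in> U" "v \<in> U" for r u v
        using SF2_isometry that U R by blast
      show "r = r'" if "r \<in> R" "r' \<in> R" "u \<in> U" "v \<in> U" "u \<noteq> v" "r u = r' u" "r v = r' v"
        for r r' u v
        using SF2_determined[of r r' u v] that U R by blast
    qed
    ultimately show "I\<^sup>2 \<le> card R * (I + sqrt 3 * card U powr (7/2))"
      by (smt (verit) mult_left_mono of_nat_0_le_iff)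
  qed
  moreover have sq: "real (card (U \<times> U)) = real (card U) ^ 2"
    by (simp add: card_cartesian_product power2_eq_square)
  ultimately show ?thesis
    unfolding sq by linarith
qed

end

section \<open>The incidence bound\<close>

theorem theorem2p8:
  shows "(\<exists>K :: real. K > 0 \<and>
            (\<forall>(q :: nat) (F :: nat ring) U P R.
               primepow q \<and> q mod 4 = 3 \<and>
               field F \<and> finite (carrier F) \<and> card (carrier F) = q \<and>
               U \<subseteq> plane F \<and> P = U \<times> U \<and> R \<subseteq> SF2' F \<longrightarrow>
               real (incidences F P R) \<le>
                 K * (real (card P) * real (card R) powr (2 / 5) + real (card R) powr (6 / 5)))) \<and>
         (\<exists>C :: real. C > 0 \<and>
            (\<forall>(q :: nat) (F :: nat ring) U P R (N :: nat).
               primepow q \<and> q mod 4 = 3 \<and>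
               field F \<and> finite (carrier F) \<and> card (carrier F) = q \<and>
               U \<subseteq> plane F \<and> P = U \<times> U \<and> R \<subseteq> SF2' F \<and>
               card P = N \<and> card R = N \<longrightarrow>
               real (incidences F P R) \<le> C * real N powr (3 / 2 - 1 / 10)))"
proof -
  have main: "real (incidences F P R)
      \<le> 2 * (real (card P) * real (card R) powr (2 / 5) + real (card R) powr (6 / 5))"
    if "q mod 4 = 3 \<and> field F \<and> finite (carrier F) \<and> card (carrier F) = q \<and>
      U \<subseteq> plane F \<and> P = U \<times> U \<and> R \<subseteq> SF2' F"
    for q and F :: "nat ring" and U P R
  proof -
    interpret field F using that by blast
    interpret euclidean_plane F
      using sum_of_squares_anisotropic that by unfold_locales blast
    show ?thesis
      using incidences_le[of U R] that by (auto simp: SF2'_def)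
  qed
  show ?thesis
  proof (intro conjI)
    show "\<exists>K :: real. K > 0 \<and>
      (\<forall>(q :: nat) (F :: nat ring) U P R.
         primepow q \<and> q mod 4 = 3 \<and>
         field F \<and> finite (carrier F) \<and> card (carrier F) = q \<and>
         U \<subseteq> plane F \<and> P = U \<times> U \<and> R \<subseteq> SF2' F \<longrightarrow>
         real (incidences F P R) \<le>
           K * (real (card P) * real (card R) powr (2 / 5) + real (card R) powr (6 / 5)))"
      by (rule exI[of _ 2], intro conjI allI impI, simp, rule main, blast)
    show "\<exists>C :: real. C > 0 \<and>
      (\<forall>(q :: nat) (F :: nat ring) U P R (N :: nat).
         primepow q \<and> q mod 4 = 3 \<and>
         field F \<and> finite (carrier F) \<and> card (carrier F) = q \<and>
         U \<subseteq> plane F \<and> P = U \<times> U \<and> R \<subseteq> SF2' F \<and>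
         card P = N \<and> card R = N \<longrightarrow>
         real (incidences F P R) \<le> C * real N powr (3 / 2 - 1 / 10))"
    proof (rule exI[of _ 4], intro conjI allI impI)
      fix q :: nat and F :: "nat ring" and U P R and N :: nat
      assume *: "primepow q \<and> q mod 4 = 3 \<and>
        field F \<and> finite (carrier F) \<and> card (carrier F) = q \<and>
        U \<subseteq> plane F \<and> P = U \<times> U \<and> R \<subseteq> SF2' F \<and> card P = N \<and> card R = N"
      have "real (incidences F P R)
          \<le> 2 * (real (card P) * real (card R) powr (2 / 5) + real (card R) powr (6 / 5))"
        by (rule main[of q F U P R]) (use * in blast)
      also have "\<dots> = 2 * (real N * real N powr (2 / 5) + real N powr (6 / 5))"
      proof -
        have "card P = N" "card R = N" using * by blast+
        thus ?thesis by simp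
      qed
      also have "\<dots> \<le> 4 * real N powr (3 / 2 - 1 / 10)"
      proof (cases "N = 0")
        case False
        have "real N * real N powr (2 / 5) = real N powr (7 / 5)"
          using False powr_add[of "real N" 1 "2 / 5"] by simp
        moreover have "real N powr (6 / 5) \<le> real N powr (7 / 5)"
          using False by (intro powr_mono) auto
        ultimately show ?thesis by simp
      qed simp
      finally show "real (incidences F P R) \<le> 4 * real N powr (3 / 2 - 1 / 10)" .
    qed simp
  qed
qed

end
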